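(* Let $\mathcal{H}$ be a separable infinite-dimensional Hilbert space and let $\mathcal{F}(\mathcal{H},\mathcal{U},\Phi)$ be given, where $\mathcal{U}$ is a group-like unitary system. For given redundancy $\rho$ assume that $\{f_k\}_{k\in\mathcal{I}}$ is a Grassmannian frame with respect to $\mathcal{F}(\mathcal{H},\mathcal{U},\Phi)$, with frame bounds $A,B$. Then there exists a uniform tight frame $\{h_k\}_{k\in\mathcal{I}}$ with $h_k=U_kh_0$, $U_k\in\mathcal{U}$, such that $$\max_{k,l\in\mathcal{I};\,k\ne l}|\langle h_k,h_l\rangle|\;\le\;\max_{k,l\in\mathcal{I};\,k\ne l}|\langle f_k,f_l\rangle|+2\max\left\{\left|1-\sqrt{\tfrac{\rho}{A}}\right|,\left|1-\sqrt{\tfrac{\rho}{B}}\right|\right\}.$$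
   Context: Throughout, $\mathcal{I}$ is a countable index set, indexed as $\{1,2,3,\dots\}$ when redundancy is computed. A sequence $\{f_k\}_{k\in\mathcal{I}}$ in $\mathcal{H}$ is a frame for $\mathcal{H}$ with frame bounds $A,B>0$ if $A\|f\|^2\le\sum_{k\in\mathcal{I}}|\langle f,f_k\rangle|^2\le B\|f\|^2$ for all $f\in\mathcal{H}$. It is tight if $A=B$, and uniform if $\|f_k\|=1$ for all $k$. Its frame operator is $Sf=\sum_{k\in\mathcal{I}}\langle f,f_k\rangle f_k$, a positive invertible operator. Redundancy: for a frame $\{f_k\}_{k=1}^\infty$ for $\mathcal{H}$ with frame operator $S$, the redundancy is $\rho:=\left(\lim_{K\to\infty}\frac1K\sum_{k=1}^K\langle f_k,S^{-1}f_k\rangle\right)^{-1}$, provided the limit exists. Unitary system: a countable set $\mathcal{U}$ of unitary operators acting on $\mathcal{H}$ and containing the identity operator. It is group-like if $\mathrm{group}(\mathcal{U})\subset\mathbb{T}\,\mathcal{U}:=\{tU: t\in\mathbb{T},\,U\in\mathcal{U}\}$, where $\mathrm{group}(\mathcal{U})$ is the group generated by $\mathcal{U}$ and $\mathbb{T}$ is the circle group, and if different $U,V\in\mathcal{U}$ are always linearly independent. The family $\mathcal{F}(\mathcal{H},\mathcal{U},\Phi)$: for a unitary system $\mathcal{U}$ and a class $\Phi$ of elements of $\mathcal{H}$ with $\|\phi\|=1$ for $\phi\in\Phi$, it is the family of frames $\{\phi_k\}_{k\in\mathcal{I}}$ for $\mathcal{H}$ of fixed redundancy $\rho$ such that $\phi_k=U_k\phi_0$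 with $\phi_0\in\Phi$, $U_k\in\mathcal{U}$, $k\in\mathcal{I}$ (here $\phi_0$, and likewise $h_0\in\mathcal{H}$ in the claim, denotes the generator). A frame $\{f_k\}_{k\in\mathcal{I}}$ is a Grassmannian frame with respect to $\mathcal{F}(\mathcal{H},\mathcal{U},\Phi)$ if, for the given $\rho$, it is a minimizer of $\max_{k,l\in\mathcal{I};\,k\ne l}|\langle\phi_k,\phi_l\rangle|$ over all $\{\phi_k\}_{k\in\mathcal{I}}\in\mathcal{F}(\mathcal{H},\mathcal{U},\Phi)$.
   Formalization: The operators U_k are taken to enumerate the whole unitary system 𝒰 without repetition, both in the family F(H,𝒰,Φ) and for h_k; if U_k may be an arbitrary selection of elements of 𝒰, the claim is false. *)

theory Defs
  imports "HOL-Analysis.Analysis" "HOL-Algebra.Bij" "HOL-Algebra.Generated_Groups"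
begin

text \<open>
  Complex Hilbert spaces. The underlying real Hilbert space is the library's; its real inner
  product is the real part of the complex one, so that
  \<^term>\<open>(norm x)\<^sup>2\<close> is the complex inner product of \<^term>\<open>x\<close> with itself and the norm,
  metric and topology are the usual ones. The complex inner product is linear in its first argument.
\<close>

class complex_hilbert_space = real_inner + complete_space +
  fixes scaleC :: "complex \<Rightarrow> 'a \<Rightarrow> 'a"  (infixr \<open>*\<^sub>C\<close> 75)
    and cinner :: "'a \<Rightarrow> 'a \<Rightarrow> complex"
  assumes scaleC_add_right: "c *\<^sub>C (x + y) = c *\<^sub>C x + c *\<^sub>C y"
    and scaleC_add_left: "(c + d) *\<^sub>C x = c *\<^sub>C x + d *\<^sub>C x"
    and scaleC_scaleC: "c *\<^sub>C d *\<^sub>C x = (c * d) *\<^sub>C x"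
    and scaleC_of_real: "complex_of_real r *\<^sub>C x = r *\<^sub>R x"
    and cinner_add_left: "cinner (x + y) z = cinner x z + cinner y z"
    and cinner_scaleC_left: "cinner (c *\<^sub>C x) y = c * cinner x y"
    and cinner_commute: "cinner x y = cnj (cinner y x)"
    and inner_eq_Re_cinner: "inner x y = Re (cinner x y)"
begin

subclass banach ..

end

interpretation complex_vector:
  vector_space "scaleC :: complex \<Rightarrow> 'a::complex_hilbert_space \<Rightarrow> 'a"
proof
  fix x :: 'a
  show "1 *\<^sub>C x = x"
    using scaleC_of_real[of 1 x] by simp
qed (simp_all add: scaleC_add_right scaleC_add_left scaleC_scaleC)

lemma cinner_self: "cinner x x = complex_of_real ((norm x)\<^sup>2)"
  for x :: "'a::complex_hilbert_space"
proof (rule complex_eqI)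
  show "Re (cinner x x) = Re (complex_of_real ((norm x)\<^sup>2))"
    by (simp add: power2_norm_eq_inner inner_eq_Re_cinner)
  have "Im (cinner x x) = Im (cnj (cinner x x))"
    by (metis cinner_commute)
  then show "Im (cinner x x) = Im (complex_of_real ((norm x)\<^sup>2))"
    by simp
qed

definition infinite_dimensional :: "'a::complex_hilbert_space itself \<Rightarrow> bool" where
  "infinite_dimensional _ \<longleftrightarrow>
     \<not> (\<exists>B::'a set. finite B \<and> complex_vector.span B = UNIV)"

text \<open>
  Frames. The countable index set is \<^typ>\<open>nat\<close>; the \<open>k\<close>-th element of a sequence indexed by
  \<open>1, 2, 3, \<dots>\<close> has index \<open>k - 1\<close> here. Summability is required explicitly because
  \<^const>\<open>infsum\<close> of a non-summable family is \<open>0\<close>.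
\<close>

definition frame_with_bounds ::
    "(nat \<Rightarrow> 'a::complex_hilbert_space) \<Rightarrow> real \<Rightarrow> real \<Rightarrow> bool" where
  "frame_with_bounds f A B \<longleftrightarrow> 0 < A \<and> 0 < B \<and>
     (\<forall>x. (\<lambda>k. (cmod (cinner x (f k)))\<^sup>2) summable_on UNIV \<and>
          A * (norm x)\<^sup>2 \<le> (\<Sum>\<^sub>\<infinity>k. (cmod (cinner x (f k)))\<^sup>2) \<and>
          (\<Sum>\<^sub>\<infinity>k. (cmod (cinner x (f k)))\<^sup>2) \<le> B * (norm x)\<^sup>2)"

definition is_frame :: "(nat \<Rightarrow> 'a::complex_hilbert_space) \<Rightarrow> bool" where
  "is_frame f \<longleftrightarrow> (\<exists>A B. frame_with_bounds f A B)"

definition tight_frame :: "(nat \<Rightarrow> 'a::complex_hilbert_space) \<Rightarrow> bool" where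
  "tight_frame f \<longleftrightarrow> (\<exists>A. frame_with_bounds f A A)"

definition uniform :: "(nat \<Rightarrow> 'a::complex_hilbert_space) \<Rightarrow> bool" where
  "uniform f \<longleftrightarrow> (\<forall>k. norm (f k) = 1)"

definition frame_operator :: "(nat \<Rightarrow> 'a::complex_hilbert_space) \<Rightarrow> 'a \<Rightarrow> 'a" where
  "frame_operator f x = (\<Sum>\<^sub>\<infinity>k. cinner x (f k) *\<^sub>C f k)"

text \<open>
  The frame operator of a frame is bijective, so \<^term>\<open>inv_into UNIV (frame_operator f)\<close> is its
  inverse. Redundancy is a relation because the limit need not exist; a limit \<open>0\<close>
  (whose reciprocal is not a real number) does not give a redundancy.
\<close>

definition has_redundancy :: "(nat \<Rightarrow> 'a::complex_hilbert_space) \<Rightarrow> real \<Rightarrow> bool" where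
  "has_redundancy f \<rho> \<longleftrightarrow>
     (\<exists>L::real. L \<noteq> 0 \<and> \<rho> = inverse L \<and>
        (\<lambda>K. (\<Sum>k<K. cinner (f k) (inv_into UNIV (frame_operator f) (f k))) / of_nat K)
          \<longlonglongrightarrow> complex_of_real L)"

definition unitary :: "('a::complex_hilbert_space \<Rightarrow> 'a) \<Rightarrow> bool" where
  "unitary U \<longleftrightarrow> Vector_Spaces.linear scaleC scaleC U \<and> surj U \<and>
     (\<forall>x y. cinner (U x) (U y) = cinner x y)"

definition unitary_system :: "('a::complex_hilbert_space \<Rightarrow> 'a) set \<Rightarrow> bool" where
  "unitary_system \<U> \<longleftrightarrow> countable \<U> \<and> id \<in> \<U> \<and> (\<forall>U\<in>\<U>. unitary U)"

text \<open>
  The group generated by a unitary system is formed in the group of all bijections of the space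
  (on \<^const>\<open>UNIV\<close>, its multiplication is composition and extensionality is vacuous).
\<close>

definition group_like :: "('a::complex_hilbert_space \<Rightarrow> 'a) set \<Rightarrow> bool" where
  "group_like \<U> \<longleftrightarrow>
     generate (BijGroup UNIV) \<U> \<subseteq> {(\<lambda>x. t *\<^sub>C U x) | t U. cmod t = 1 \<and> U \<in> \<U>} \<and>
     (\<forall>U\<in>\<U>. \<forall>V\<in>\<U>. U \<noteq> V \<longrightarrow>
        (\<forall>a b. (\<forall>x. a *\<^sub>C U x + b *\<^sub>C V x = 0) \<longrightarrow> a = 0 \<and> b = 0))"

text \<open>
  The members of the family are the orbits of generators in \<open>\<Phi>\<close> under the \<^emph>\<open>whole\<close> system, i.e.
  \<open>k \<mapsto> U\<^sub>k\<close> enumerates \<open>\<U>\<close> without repetition; any enumeration is admitted.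
\<close>

definition frame_family ::
    "('a::complex_hilbert_space \<Rightarrow> 'a) set \<Rightarrow> 'a set \<Rightarrow> real \<Rightarrow> (nat \<Rightarrow> 'a) set" where
  "frame_family \<U> \<Phi> \<rho> =
     {\<phi>. is_frame \<phi> \<and> has_redundancy \<phi> \<rho> \<and>
        (\<exists>U. bij_betw U UNIV \<U> \<and> (\<exists>\<phi>\<^sub>0\<in>\<Phi>. \<forall>k. \<phi> k = U k \<phi>\<^sub>0))}"

text \<open>
  The maximum over the infinite index set is written as a supremum, which is over a set bounded
  by \<open>1\<close> for unit vectors. For a frame that is the orbit of a unit vector under a group-like system
  the supremum is attained.
\<close>

definition max_correlation :: "(nat \<Rightarrow> 'a::complex_hilbert_space) \<Rightarrow> real" where
  "max_correlation \<phi> = (SUP (k, l) \<in> {(k, l). k \<noteq> l}. cmod (cinner (\<phi> k) (\<phi> l)))"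

definition grassmannian_frame ::
    "('a::complex_hilbert_space \<Rightarrow> 'a) set \<Rightarrow> 'a set \<Rightarrow> real \<Rightarrow> (nat \<Rightarrow> 'a) \<Rightarrow> bool" where
  "grassmannian_frame \<U> \<Phi> \<rho> f \<longleftrightarrow>
     is_arg_min max_correlation (\<lambda>\<phi>. \<phi> \<in> frame_family \<U> \<Phi> \<rho>) f"

end

theory Submission
  imports Defs
begin

text \<open>
  Let \<open>S\<close> be the frame operator of the Grassmannian frame. As \<open>\<U>\<close> is a group up to unimodular
  factors, \<open>S\<close> and hence \<open>R = S powr (- 1 / 2)\<close> commute with every \<open>U k\<close>. Therefore
  \<open>\<langle>f k, S powr (- 1) (f k)\<rangle> = \<parallel>R f\<^sub>0\<parallel>\<^sup>2\<close> does not depend on \<open>k\<close> and equals \<open>1 / \<rho>\<close>, so the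
  canonical tight frame, rescaled to \<open>h k = sqrt \<rho> R (f k) = U k (sqrt \<rho> R f\<^sub>0)\<close>, consists of unit
  vectors. Passing from \<open>f\<close> to \<open>h\<close> changes inner products by at most \<open>2 \<parallel>h\<^sub>0 - f\<^sub>0\<parallel>\<close>, and the
  numerical range of \<open>1 - sqrt \<rho> R\<close> lies between \<open>1 - sqrt (\<rho> / A)\<close> and \<open>1 - sqrt (\<rho> / B)\<close>.
\<close>

section \<open>The inverse square root of a positive operator\<close>

text \<open>The coefficient of \<open>z ^ n\<close> in \<open>(1 - z) powr (- 1 / 2)\<close>, that
  is \<open>pochhammer (1 / 2) n / fact n\<close>. The sign makes all coefficients nonnegative, so
  termwise estimates are possible.\<close>

definition inv_sqrt_coeff :: "nat \<Rightarrow> real" where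
  "inv_sqrt_coeff n = (- 1) ^ n * ((- 1 / 2) gchoose n)"

lemma inv_sqrt_coeff_nonneg: "0 \<le> inv_sqrt_coeff n"
proof -
  have "inv_sqrt_coeff n = pochhammer (1 / 2) n / fact n"
    by (simp add: inv_sqrt_coeff_def gbinomial_pochhammer flip: power_add)
  then show ?thesis
    by (simp add: pochhammer_nonneg)
qed

lemma inv_sqrt_coeff_0: "inv_sqrt_coeff 0 = 1"
  by (simp add: inv_sqrt_coeff_def)

text \<open>The square of the series is \<open>1 / (1 - z)\<close>, the geometric series. On
  coefficients this is Vandermonde's convolution together with
  \<open>(- 1) gchoose n = (- 1) ^ n\<close>.\<close>

lemma inv_sqrt_coeff_convolution: "(\<Sum>k\<le>n. inv_sqrt_coeff k * inv_sqrt_coeff (n - k)) = 1"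
proof -
  have "(\<Sum>k\<le>n. inv_sqrt_coeff k * inv_sqrt_coeff (n - k))
      = (\<Sum>k\<le>n. (- 1) ^ n * ((- 1 / 2 gchoose k) * (- 1 / 2 gchoose (n - k))))"
  proof (rule sum.cong)
    fix k assume "k \<in> {..n}"
    then have "(- 1 :: real) ^ k * (- 1) ^ (n - k) = (- 1) ^ n"
      by (simp flip: power_add)
    moreover have "inv_sqrt_coeff k * inv_sqrt_coeff (n - k)
        = ((- 1) ^ k * (- 1) ^ (n - k)) * ((- 1 / 2 gchoose k) * (- 1 / 2 gchoose (n - k)))"
      unfolding inv_sqrt_coeff_def by (simp only: mult_ac)
    ultimately show "inv_sqrt_coeff k * inv_sqrt_coeff (n - k)
        = (- 1) ^ n * ((- 1 / 2 gchoose k) * (- 1 / 2 gchoose (n - k)))"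
      by (simp only:)
  qed simp
  also have "\<dots> = (- 1) ^ n * ((- 1 :: real) gchoose n)"
    using gbinomial_Vandermonde[of "- 1 / 2 :: real" "- 1 / 2" n]
    by (simp add: atMost_atLeast0 flip: sum_distrib_left)
  also have "\<dots> = 1"
    by (simp add: gbinomial_pochhammer pochhammer_fact[symmetric] flip: power_add)
  finally show ?thesis .
qed

lemma inv_sqrt_coeff_sums:
  assumes "\<bar>q\<bar> < 1"
  shows "(\<lambda>n. inv_sqrt_coeff n * q ^ n) sums (1 / sqrt (1 - q))"
proof -
  have "(\<lambda>n. (- 1 / 2 gchoose n) * (- q) ^ n) sums (1 + - q) powr (- 1 / 2)"
    using assms by (intro gen_binomial_real) simp
  moreover have "(- 1 / 2 gchoose n) * (- q) ^ n = inv_sqrt_coeff n * q ^ n" for n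
    unfolding inv_sqrt_coeff_def by (subst power_minus) simp
  moreover have "(1 - q) powr (- 1 / 2) = 1 / sqrt (1 - q)"
    using assms by (simp add: powr_minus_divide powr_half_sqrt)
  ultimately show ?thesis
    by simp
qed

text \<open>For self-adjoint operators the quadratic form controls the norm: polarisation expresses
  \<open>inner (D x) y\<close> through the form at \<open>x + y\<close> and \<open>x - y\<close>,
  and the parallelogram law adds up the two bounds.\<close>

lemma norm_le_of_quadratic_form_le:
  fixes D :: "'a::real_inner \<Rightarrow> 'a"
  assumes "linear D" and selfadj: "\<And>x y. inner (D x) y = inner x (D y)"
    and bound: "\<And>x. \<bar>inner (D x) x\<bar> \<le> m * (norm x)\<^sup>2"
  shows "norm (D x) \<le> m * norm x"
proof (cases "D x = 0")
  case True
  have "0 \<le> m * (norm x)\<^sup>2"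
    using bound[of x] by linarith
  then show ?thesis
    by (cases "x = 0") (auto simp: True zero_le_mult_iff linear_0[OF assms(1)])
next
  case False
  interpret linear D by fact
  \<comment> \<open>The direction of \<open>D x\<close> makes \<open>inner (D x) y\<close> as large
    as possible; the length of \<open>x\<close> makes the parallelogram law give exactly
    \<open>4 * (norm x)\<^sup>2\<close>.\<close>
  define y where "y = (norm x / norm (D x)) *\<^sub>R D x"
  have norm_y: "norm y = norm x"
    using False by (simp add: y_def)
  have "4 * inner (D x) y = inner (D (x + y)) (x + y) - inner (D (x - y)) (x - y)"
    using selfadj[of x y] by (simp add: add diff inner_simps inner_commute)
  also have "\<dots> \<le> m * (norm (x + y))\<^sup>2 + m * (norm (x - y))\<^sup>2"
    using bound[of "x + y"] bound[of "x - y"] by linarith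
  also have "\<dots> = 4 * (m * (norm x)\<^sup>2)"
  proof -
    have "(norm (x + y))\<^sup>2 + (norm (x - y))\<^sup>2 = 4 * (norm x)\<^sup>2"
      using arg_cong[OF norm_y, of "\<lambda>r. r\<^sup>2"]
      by (simp add: power2_norm_eq_inner inner_simps inner_commute)
    then show ?thesis
      by (simp flip: distrib_left)
  qed
  finally have "inner (D x) y \<le> m * (norm x)\<^sup>2"
    by simp
  moreover have "inner (D x) y = norm x * norm (D x)"
    using False by (simp add: y_def field_simps power2_eq_square flip: power2_norm_eq_inner)
  ultimately have "norm x * norm (D x) \<le> norm x * (m * norm x)"
    by (simp add: power2_eq_square mult_ac)
  moreover have "norm x > 0"
    using False zero by auto
  ultimately show ?thesis
    by simp
qed

section \<open>Binomial calculus for a positive contraction\<close>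

locale positive_contraction =
  fixes T :: "'a::{real_inner,banach} \<Rightarrow> 'a" and q :: real
  assumes linear: "linear T"
    and selfadj: "inner (T x) y = inner x (T y)"
    and nonneg: "0 \<le> inner (T x) x"
    and le: "inner (T x) x \<le> q * (norm x)\<^sup>2"
    and q: "0 \<le> q" "q < 1"
begin

lemma norm_le: "norm (T x) \<le> q * norm x"
  using nonneg le by (intro norm_le_of_quadratic_form_le linear selfadj) auto

lemma bounded_linear: "bounded_linear T"
  using linear norm_le by (intro bounded_linear.intro bounded_linear_axioms.intro) (auto simp: mult.commute)

lemma bounded_linear_funpow: "bounded_linear (T ^^ n)"
  by (induction n) (simp_all add: bounded_linear_ident bounded_linear_compose[OF bounded_linear] o_def id_def)

lemma norm_funpow_le: "norm ((T ^^ n) x) \<le> q ^ n * norm x"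
proof (induction n)
  case (Suc n)
  have "norm (T ((T ^^ n) x)) \<le> q * norm ((T ^^ n) x)"
    by (rule norm_le)
  also have "\<dots> \<le> q * (q ^ n * norm x)"
    using Suc q by (intro mult_left_mono)
  finally show ?case
    by (simp add: mult_ac)
qed simp

lemma selfadj_funpow: "inner ((T ^^ n) x) y = inner x ((T ^^ n) y)"
  by (induction n arbitrary: x y) (simp_all add: selfadj funpow_swap1)

text \<open>Moving half of the factors to the other side leaves \<open>inner v v\<close> or
  \<open>inner (T v) v\<close> with \<open>v = (T ^^ m) x\<close>.\<close>

lemma funpow_nonneg: "0 \<le> inner ((T ^^ n) x) x"
proof -
  define m where "m = n div 2"
  show ?thesis
  proof (cases "even n")
    case True
    then have "(T ^^ n) x = (T ^^ m) ((T ^^ m) x)"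
      by (metis m_def comp_apply funpow_add dvd_mult_div_cancel mult_2)
    then show ?thesis
      using selfadj_funpow[of m "(T ^^ m) x" x] by simp
  next
    case False
    then have "n = m + Suc m"
      unfolding m_def by presburger
    then have "(T ^^ n) x = (T ^^ m) (T ((T ^^ m) x))"
      by (simp only: funpow_add funpow.simps o_apply)
    then show ?thesis
      using selfadj_funpow[of m "T ((T ^^ m) x)" x] nonneg by simp
  qed
qed

lemma funpow_le: "inner ((T ^^ n) x) x \<le> q ^ n * (norm x)\<^sup>2"
proof -
  have "inner ((T ^^ n) x) x \<le> norm ((T ^^ n) x) * norm x"
    by (rule norm_cauchy_schwarz)
  also have "\<dots> \<le> (q ^ n * norm x) * norm x"
    by (intro mult_right_mono norm_funpow_le) simp
  finally show ?thesis
    by (simp add: power2_eq_square mult_ac)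
qed

text \<open>The inverse square root of \<open>1 - T\<close>, not of \<open>T\<close>, by its
  binomial series.\<close>

definition inv_sqrt :: "'a \<Rightarrow> 'a" where
  "inv_sqrt x = (\<Sum>\<^sub>\<infinity>n. inv_sqrt_coeff n *\<^sub>R (T ^^ n) x)"

lemma coeff_sums: "(\<lambda>n. inv_sqrt_coeff n * q ^ n) sums (1 / sqrt (1 - q))"
  using q by (intro inv_sqrt_coeff_sums) simp

lemma coeff_has_sum: "((\<lambda>n. inv_sqrt_coeff n * q ^ n) has_sum (1 / sqrt (1 - q))) UNIV"
  by (intro sums_nonneg_imp_has_sum coeff_sums) (simp add: inv_sqrt_coeff_nonneg q)

lemma inv_sqrt_has_sum: "((\<lambda>n. inv_sqrt_coeff n *\<^sub>R (T ^^ n) x) has_sum inv_sqrt x) UNIV"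
proof -
  have "norm (inv_sqrt_coeff n *\<^sub>R (T ^^ n) x) \<le> inv_sqrt_coeff n * q ^ n * norm x" for n
    using mult_left_mono[OF norm_funpow_le inv_sqrt_coeff_nonneg]
    by (simp add: inv_sqrt_coeff_nonneg mult.assoc)
  then have "(\<lambda>n. norm (inv_sqrt_coeff n *\<^sub>R (T ^^ n) x)) summable_on UNIV"
    by (rule Infinite_Sum.abs_summable_on_comparison_test'
          [OF has_sum_imp_summable[OF has_sum_cmult_left[OF coeff_has_sum]]])
  then show ?thesis
    unfolding inv_sqrt_def by (rule has_sum_infsum[OF abs_summable_summable])
qed

text \<open>\<open>V\<close> passes through every term of the series. This is used three times over:
  for real scalars, for complex scalars, and for the unitaries of the system.\<close>

lemma inv_sqrt_commute:
  assumes "bounded_linear V" and comm: "\<And>x. V (T x) = T (V x)"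
  shows "V (inv_sqrt x) = inv_sqrt (V x)"
proof -
  interpret V: bounded_linear V by fact
  have "V ((T ^^ n) x) = (T ^^ n) (V x)" for n
    by (induction n) (simp_all add: comm)
  then have "((\<lambda>n. inv_sqrt_coeff n *\<^sub>R (T ^^ n) (V x)) has_sum V (inv_sqrt x)) UNIV"
    using has_sum_bounded_linear[OF assms(1) inv_sqrt_has_sum[of x]] by (simp add: V.scaleR)
  then show ?thesis
    using inv_sqrt_has_sum has_sum_unique by blast
qed

lemma linear_inv_sqrt: "linear inv_sqrt"
proof (rule linearI)
  fix x y :: 'a and r :: real
  interpret T: bounded_linear "T ^^ n" for n by (rule bounded_linear_funpow)
  show "inv_sqrt (x + y) = inv_sqrt x + inv_sqrt y"
    using has_sum_add[OF inv_sqrt_has_sum[of x] inv_sqrt_has_sum[of y]] inv_sqrt_has_sum[of "x + y"]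
    by (simp add: T.add scaleR_right_distrib has_sum_unique)
  show "inv_sqrt (r *\<^sub>R x) = r *\<^sub>R inv_sqrt x"
    using linear by (intro inv_sqrt_commute[symmetric] bounded_linear_scaleR_right) (simp add: linear_cmul)
qed

lemma inner_inv_sqrt_sums:
  "(\<lambda>n. inv_sqrt_coeff n * inner ((T ^^ n) x) y) sums inner (inv_sqrt x) y"
  using has_sum_bounded_linear[OF bounded_linear_inner_left inv_sqrt_has_sum]
  by (auto dest: has_sum_imp_sums)

lemma selfadj_inv_sqrt: "inner (inv_sqrt x) y = inner x (inv_sqrt y)"
proof -
  have "inner ((T ^^ n) x) y = inner ((T ^^ n) y) x" for n
    by (metis selfadj_funpow inner_commute)
  then have "inner (inv_sqrt x) y = inner (inv_sqrt y) x"
    using sums_unique2[OF inner_inv_sqrt_sums[of x y]] inner_inv_sqrt_sums[of y x] by simp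
  then show ?thesis
    by (simp add: inner_commute)
qed

text \<open>The term of index \<open>0\<close> is already \<open>(norm x)\<^sup>2\<close>, and all
  others are nonnegative.\<close>

lemma inv_sqrt_ge: "(norm x)\<^sup>2 \<le> inner (inv_sqrt x) x"
proof -
  have "(\<Sum>n\<in>{0}. inv_sqrt_coeff n * inner ((T ^^ n) x) x) \<le> (\<Sum>n. inv_sqrt_coeff n * inner ((T ^^ n) x) x)"
    by (intro sum_le_suminf)
       (auto intro: sums_summable[OF inner_inv_sqrt_sums] simp: inv_sqrt_coeff_nonneg funpow_nonneg)
  then show ?thesis
    by (simp add: inv_sqrt_coeff_0 power2_norm_eq_inner sums_unique[OF inner_inv_sqrt_sums, symmetric])
qed

text \<open>Termwise comparison with the scalar series at \<open>q\<close>.\<close>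

lemma inv_sqrt_le: "inner (inv_sqrt x) x \<le> (norm x)\<^sup>2 / sqrt (1 - q)"
proof -
  have "inv_sqrt_coeff n * inner ((T ^^ n) x) x \<le> inv_sqrt_coeff n * q ^ n * (norm x)\<^sup>2" for n
    using mult_left_mono[OF funpow_le inv_sqrt_coeff_nonneg] by (simp add: mult.assoc)
  from sums_le[OF this inner_inv_sqrt_sums sums_mult2[OF coeff_sums]] show ?thesis
    by simp
qed

text \<open>The double series \<open>g\<close> is summed in two ways: by rows it gives
  \<open>inv_sqrt\<close> applied twice, by antidiagonals the convolution identity collapses it to
  the Neumann series of \<open>1 - T\<close>.\<close>

lemma inv_sqrt_twice_has_sum: "((\<lambda>n. (T ^^ n) x) has_sum inv_sqrt (inv_sqrt x)) UNIV"
proof -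
  let ?c = inv_sqrt_coeff
  define g where "g = (\<lambda>(m, n). (?c m * ?c n) *\<^sub>R (T ^^ (m + n)) x)"
  \<comment> \<open>The scalar double series at \<open>q\<close> is the majorant that makes the
    rearrangement legitimate.\<close>
  define b where "b = (\<lambda>(m, n). (?c m * q ^ m) * ((?c n * q ^ n) * norm x))"
  have "b summable_on UNIV \<times> UNIV"
  proof (rule summable_on_SigmaI)
    show "((\<lambda>n. b (m, n)) has_sum (?c m * q ^ m) * (1 / sqrt (1 - q) * norm x)) UNIV" for m
      unfolding b_def prod.case by (intro has_sum_cmult_right has_sum_cmult_left coeff_has_sum)
    show "(\<lambda>m. (?c m * q ^ m) * (1 / sqrt (1 - q) * norm x)) summable_on UNIV"
      using has_sum_cmult_left[OF coeff_has_sum] by (rule has_sum_imp_summable)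
  qed (simp add: b_def inv_sqrt_coeff_nonneg q)
  moreover have "norm (g p) \<le> b p" for p
  proof (cases p)
    case (Pair m n)
    have "\<bar>?c m * ?c n\<bar> * norm ((T ^^ (m + n)) x) \<le> (?c m * ?c n) * (q ^ (m + n) * norm x)"
      using mult_left_mono[OF norm_funpow_le, of "?c m * ?c n"] inv_sqrt_coeff_nonneg by simp
    then show ?thesis
      by (simp add: Pair g_def b_def power_add mult_ac del: abs_mult)
  qed
  ultimately have "(\<lambda>p. norm (g p)) summable_on UNIV \<times> UNIV"
    by (rule Infinite_Sum.abs_summable_on_comparison_test')
  then have "g summable_on UNIV \<times> UNIV"
    by (rule abs_summable_summable)
  then obtain G where G: "(g has_sum G) (UNIV \<times> UNIV)"
    by (auto simp: summable_on_def)
  have "((\<lambda>n. g (m, n)) has_sum ?c m *\<^sub>R (T ^^ m) (inv_sqrt x)) UNIV" for m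
  proof -
    interpret T: bounded_linear "T ^^ m" by (rule bounded_linear_funpow)
    have "bounded_linear (\<lambda>y. ?c m *\<^sub>R (T ^^ m) y)"
      by (intro bounded_linear_scaleR_right[THEN bounded_linear_compose] T.bounded_linear_axioms)
    from has_sum_bounded_linear[OF this inv_sqrt_has_sum] show ?thesis
      by (simp add: g_def T.scaleR funpow_add)
  qed
  from has_sum_SigmaD[OF G this] have "inv_sqrt (inv_sqrt x) = G"
    using inv_sqrt_has_sum has_sum_unique by blast
  \<comment> \<open>Antidiagonals: the pair \<open>(m, n)\<close> is renamed to
    \<open>(m + n, m)\<close>.\<close>
  moreover have "((\<lambda>(n, k). g (k, n - k)) has_sum G) (SIGMA n:UNIV. {..n})"
    using G
    by (subst has_sum_reindex_bij_witness[where j = "\<lambda>(n, k). (k, n - k)"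
          and i = "\<lambda>(m, n). (m + n, m)" and T = "UNIV \<times> UNIV" and h = g and s' = G]) auto
  then have "((\<lambda>n. (T ^^ n) x) has_sum G) UNIV"
  proof (rule has_sum_SigmaD)
    fix n :: nat
    have "(\<Sum>k\<le>n. g (k, n - k)) = (\<Sum>k\<le>n. ?c k * ?c (n - k)) *\<^sub>R (T ^^ n) x"
      unfolding scaleR_sum_left by (intro sum.cong) (auto simp: g_def)
    then show "((\<lambda>k. case (n, k) of (n, k) \<Rightarrow> g (k, n - k)) has_sum (T ^^ n) x) {..n}"
      by (intro has_sum_finiteI) (simp_all add: inv_sqrt_coeff_convolution)
  qed
  ultimately show ?thesis
    by simp
qed

text \<open>Applying \<open>T\<close> shifts the Neumann series by one place, so the difference is
  its first term.\<close>

lemma inv_sqrt_twice: "inv_sqrt (inv_sqrt x) - T (inv_sqrt (inv_sqrt x)) = x"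
proof -
  let ?G = "inv_sqrt (inv_sqrt x)"
  have G: "(\<lambda>n. (T ^^ n) x) sums ?G"
    using inv_sqrt_twice_has_sum by (rule has_sum_imp_sums)
  have "(\<lambda>n. (T ^^ Suc n) x) sums T ?G"
    using bounded_linear.sums[OF bounded_linear G] by simp
  moreover have "(\<lambda>n. (T ^^ Suc n) x) sums (?G - x)"
    using G by (subst sums_Suc_iff) simp
  ultimately show ?thesis
    using sums_unique2 by fastforce
qed

end

text \<open>The root of the inverse is the binomial series of \<open>(1 - T) powr (- 1 / 2)\<close>, where
  \<open>T = 1 - S / B\<close>; its coefficients are nonnegative, which gives the two-sided bound.\<close>

lemma inverse_square_root:
  fixes S :: "'a::{real_inner,banach} \<Rightarrow> 'a"
  assumes "linear S" and selfadj: "\<And>x y. inner (S x) y = inner x (S y)"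
    and lower: "\<And>x. A * (norm x)\<^sup>2 \<le> inner (S x) x"
    and upper: "\<And>x. inner (S x) x \<le> B * (norm x)\<^sup>2"
    and "0 < A" "A \<le> B"
  obtains R where "linear R" and "\<And>x y. inner (R x) y = inner x (R y)"
    and "\<And>x. S (R (R x)) = x" and "\<And>x. R (R (S x)) = x"
    and "\<And>x. (norm x)\<^sup>2 / sqrt B \<le> inner (R x) x"
    and "\<And>x. inner (R x) x \<le> (norm x)\<^sup>2 / sqrt A"
    and "\<And>V x. bounded_linear V \<Longrightarrow> (\<And>x. V (S x) = S (V x)) \<Longrightarrow> V (R x) = R (V x)"
proof -
  interpret S: linear S by fact
  have B: "0 < B"
    using assms by simp
  \<comment> \<open>The bounds \<open>A\<close> and \<open>B\<close> for the form of
    \<open>S\<close> become \<open>0\<close> and \<open>1 - A / B\<close> for that of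
    \<open>T\<close>.\<close>
  define T where "T x = x - (1 / B) *\<^sub>R S x" for x
  interpret positive_contraction T "1 - A / B"
  proof
    show "T (x + y) = T x + T y" "T (r *\<^sub>R x) = r *\<^sub>R T x" for x y r
      by (simp_all add: T_def S.add S.scale algebra_simps)
    show "inner (T x) y = inner x (T y)" for x y
      by (simp add: T_def inner_simps selfadj)
    show "0 \<le> inner (T x) x" "inner (T x) x \<le> (1 - A / B) * (norm x)\<^sup>2" for x
      using lower[of x] upper[of x] B
      by (simp_all add: T_def inner_simps field_simps flip: power2_norm_eq_inner)
    show "0 \<le> 1 - A / B" "1 - A / B < 1"
      using assms B by simp_all
  qed
  have S_eq: "S x = B *\<^sub>R (x - T x)" for x
    using B by (simp add: T_def)
  \<comment> \<open>Since \<open>S = B (1 - T)\<close>, the root of the inverse acquires the factor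
    \<open>1 / sqrt B\<close>.\<close>
  define R where "R x = (1 / sqrt B) *\<^sub>R inv_sqrt x" for x
  interpret Y: linear inv_sqrt by (rule linear_inv_sqrt)
  have RR: "R (R x) = (1 / B) *\<^sub>R inv_sqrt (inv_sqrt x)" for x
    using B by (simp add: R_def Y.scale)
  have T_scale: "T (r *\<^sub>R x) = r *\<^sub>R T x" for r x
    using linear by (rule linear_cmul)
  have SRR: "S (R (R x)) = x" for x
    using B inv_sqrt_twice[of x] by (simp add: S_eq RR T_scale flip: scaleR_diff_right)
  have comm: "V (R x) = R (V x)" if V: "bounded_linear V" and VS: "\<And>x. V (S x) = S (V x)" for V x
  proof -
    interpret V: bounded_linear V by fact
    have "V (T y) = T (V y)" for y
      by (simp add: T_def V.diff V.scaleR VS)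
    with V show ?thesis
      by (simp add: R_def V.scaleR inv_sqrt_commute)
  qed
  have "bounded_linear S"
    unfolding S_eq
    by (intro bounded_linear_scaleR_right[THEN bounded_linear_compose] bounded_linear_sub
        bounded_linear_ident bounded_linear)
  \<comment> \<open>\<open>S\<close> commutes with itself, hence with \<open>R\<close>, and the
    right inverse \<open>R R\<close> is also a left inverse.\<close>
  then have "R (S x) = S (R x)" for x
    using comm by metis
  then have RRS: "R (R (S x)) = x" for x
    using SRR by metis
  show thesis
  proof (rule that[of R])
    show "linear R"
      unfolding R_def by (intro linear_compose_scale_right linear_inv_sqrt)
    show "inner (R x) y = inner x (R y)" for x y
      by (simp add: R_def selfadj_inv_sqrt)
    show "(norm x)\<^sup>2 / sqrt B \<le> inner (R x) x" for x
      using inv_sqrt_ge[of x] B by (simp add: R_def divide_right_mono)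
    show "inner (R x) x \<le> (norm x)\<^sup>2 / sqrt A" for x
    proof -
      have "inner (R x) x \<le> (norm x)\<^sup>2 / sqrt (A / B) / sqrt B"
        using divide_right_mono[OF inv_sqrt_le[of x], of "sqrt B"] B by (simp add: R_def)
      also have "\<dots> = (norm x)\<^sup>2 / sqrt A"
        using B by (simp add: real_sqrt_divide)
      finally show ?thesis .
    qed
  qed (use SRR RRS comm in auto)
qed

section \<open>Frame operators\<close>

lemma cinner_add_right: "cinner x (y + z) = cinner x y + cinner x z"
  for x :: "'a::complex_hilbert_space"
  by (metis cinner_add_left cinner_commute complex_cnj_add)

lemma cinner_scaleC_right: "cinner x (c *\<^sub>C y) = cnj c * cinner x y"
  for x :: "'a::complex_hilbert_space"
  by (metis cinner_scaleC_left cinner_commute complex_cnj_mult)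

lemma norm_scaleC: "norm (c *\<^sub>C x) = cmod c * norm x"
  for x :: "'a::complex_hilbert_space"
proof -
  have "complex_of_real ((norm (c *\<^sub>C x))\<^sup>2) = (c * cnj c) * cinner x x"
    unfolding cinner_self[symmetric] by (simp add: cinner_scaleC_left cinner_scaleC_right)
  also have "\<dots> = complex_of_real ((cmod c * norm x)\<^sup>2)"
    by (simp add: cinner_self power_mult_distrib flip: complex_norm_square)
  finally show ?thesis
    by (metis norm_ge_zero mult_nonneg_nonneg of_real_eq_iff power2_eq_imp_eq)
qed

text \<open>A unimodular factor \<open>t\<close> turns the complex inner product into its modulus,
  after which the real Cauchy-Schwarz inequality applies.\<close>

lemma cmod_cinner_le: "cmod (cinner x y) \<le> norm x * norm y"
  for x :: "'a::complex_hilbert_space"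
proof -
  obtain t where t: "cmod t = 1" "t * cinner x y = cmod (cinner x y)"
  proof (cases "cinner x y = 0")
    case False
    then show thesis
      by (intro that[of "cnj (cinner x y) / cmod (cinner x y)"])
         (simp_all add: norm_divide complex_norm_square[symmetric] power2_eq_square mult.commute)
  qed (use that[of 1] in simp)
  have "cmod (cinner x y) = Re (cinner (t *\<^sub>C x) y)"
    by (simp add: cinner_scaleC_left t)
  also have "\<dots> \<le> norm (t *\<^sub>C x) * norm y"
    by (metis inner_eq_Re_cinner norm_cauchy_schwarz)
  finally show ?thesis
    by (simp add: norm_scaleC t)
qed

lemma bounded_linear_scaleC: "bounded_linear ((*\<^sub>C) c :: 'a::complex_hilbert_space \<Rightarrow> 'a)"
proof
  show "c *\<^sub>C (r *\<^sub>R x) = r *\<^sub>R (c *\<^sub>C x)" for r and x :: 'a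
    by (simp add: scaleC_scaleC mult.commute flip: scaleC_of_real)
  show "\<exists>K. \<forall>x::'a. norm (c *\<^sub>C x) \<le> norm x * K"
    by (rule exI[of _ "cmod c"]) (simp add: norm_scaleC mult.commute)
qed (rule scaleC_add_right)

lemma bounded_linear_cinner_left: "bounded_linear (\<lambda>x. cinner x y)"
  for y :: "'a::complex_hilbert_space"
proof
  show "cinner (r *\<^sub>R x) y = r *\<^sub>R cinner x y" for r x
    by (simp add: cinner_scaleC_left scaleR_conv_of_real flip: scaleC_of_real)
  show "\<exists>K. \<forall>x. cmod (cinner x y) \<le> norm x * K"
    using cmod_cinner_le by blast
qed (rule cinner_add_left)

lemma bounded_linear_cinner_right: "bounded_linear (cinner x)"
  for x :: "'a::complex_hilbert_space"
proof
  show "cinner x (r *\<^sub>R y) = r *\<^sub>R cinner x y" for r y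
    by (simp add: cinner_scaleC_right scaleR_conv_of_real flip: scaleC_of_real)
  show "\<exists>K. \<forall>y. cmod (cinner x y) \<le> norm y * K"
    using cmod_cinner_le by (auto simp: mult.commute)
qed (rule cinner_add_right)

lemma cinner_diff_left: "cinner (x - y) z = cinner x z - cinner y z"
  for x :: "'a::complex_hilbert_space"
  by (rule bounded_linear.linear[OF bounded_linear_cinner_left, THEN linear_diff])

lemma cinner_diff_right: "cinner z (x - y) = cinner z x - cinner z y"
  for x :: "'a::complex_hilbert_space"
  by (rule bounded_linear.linear[OF bounded_linear_cinner_right, THEN linear_diff])

text \<open>The real hypothesis gives equality of real parts; replacing \<open>x\<close> by
  \<open>\<i> *\<^sub>C x\<close> turns imaginary parts into real ones.\<close>

lemma cinner_adjoint_if_inner_adjoint: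
  fixes R :: "'a::complex_hilbert_space \<Rightarrow> 'a"
  assumes adj: "\<And>x y. inner (R x) y = inner x (R y)"
    and scaleC: "\<And>c x. R (c *\<^sub>C x) = c *\<^sub>C R x"
  shows "cinner (R x) y = cinner x (R y)"
proof (rule complex_eqI)
  have Re: "Re (cinner (R x) y) = Re (cinner x (R y))" for x y
    using adj by (simp add: inner_eq_Re_cinner)
  then show "Re (cinner (R x) y) = Re (cinner x (R y))" .
  show "Im (cinner (R x) y) = Im (cinner x (R y))"
    using Re[of "\<i> *\<^sub>C x" y] by (simp add: scaleC cinner_scaleC_left)
qed

section \<open>Unitary operators\<close>

lemma unitary_cinner: "unitary U \<Longrightarrow> cinner (U x) (U y) = cinner x y"
  by (simp add: unitary_def)

lemma unitary_norm: "unitary U \<Longrightarrow> norm (U x) = norm x"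
  using unitary_cinner[of U x x] unfolding cinner_self
  by (metis norm_ge_zero of_real_eq_iff power2_eq_imp_eq)

lemma unitary_add: "unitary U \<Longrightarrow> U (x + y) = U x + U y"
  and unitary_scaleC: "unitary U \<Longrightarrow> U (c *\<^sub>C x) = c *\<^sub>C U x"
  unfolding unitary_def Vector_Spaces.linear_iff_module_hom
  by (auto intro: module_hom.add module_hom.scale)

lemma unitary_bounded_linear: "unitary U \<Longrightarrow> bounded_linear U"
  by (rule bounded_linear_intro[where K = 1])
     (simp_all add: unitary_add unitary_scaleC unitary_norm flip: scaleC_of_real)

lemma unitary_bij: "unitary U \<Longrightarrow> bij U"
proof (rule bijI)
  assume U: "unitary U"
  show "inj U"
  proof (rule injI)
    fix x y assume "U x = U y"
    then have "U (x - y) = 0"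
      by (simp add: linear_diff[OF bounded_linear.linear[OF unitary_bounded_linear[OF U]]])
    then show "x = y"
      using unitary_norm[OF U, of "x - y"] by simp
  qed
qed (simp add: unitary_def)

section \<open>Synthesis and the frame operator\<close>

context
  fixes f :: "nat \<Rightarrow> 'a::complex_hilbert_space" and A B :: real
  assumes frame: "frame_with_bounds f A B"
begin

lemma frame_summable: "(\<lambda>k. (cmod (cinner x (f k)))\<^sup>2) summable_on UNIV"
  and frame_lower: "A * (norm x)\<^sup>2 \<le> (\<Sum>\<^sub>\<infinity>k. (cmod (cinner x (f k)))\<^sup>2)"
  and frame_upper: "(\<Sum>\<^sub>\<infinity>k. (cmod (cinner x (f k)))\<^sup>2) \<le> B * (norm x)\<^sup>2"
  and frame_bounds_pos: "0 < A" "0 < B"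
  using frame by (simp_all add: frame_with_bounds_def)

text \<open>Pairing the sum \<open>v\<close> with itself, Cauchy-Schwarz and the upper frame bound
  at \<open>v\<close> give the claim multiplied by \<open>(norm v)\<^sup>2\<close>, which is then
  cancelled.\<close>

lemma frame_synthesis_bound:
  assumes "finite F"
  shows "(norm (\<Sum>k\<in>F. c k *\<^sub>C f k))\<^sup>2 \<le> B * (\<Sum>k\<in>F. (cmod (c k))\<^sup>2)"
proof -
  define v where "v = (\<Sum>k\<in>F. c k *\<^sub>C f k)"
  define s where "s = (\<Sum>k\<in>F. (cmod (c k))\<^sup>2)"
  have "cinner v v = (\<Sum>k\<in>F. c k * cinner (f k) v)"
    by (subst v_def)
       (simp add: linear_sum[OF bounded_linear.linear[OF bounded_linear_cinner_left]] cinner_scaleC_left)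
  then have "(norm v)\<^sup>2 = cmod (\<Sum>k\<in>F. c k * cinner (f k) v)"
    by (metis abs_of_nonneg cinner_self norm_of_real zero_le_power2)
  also have "\<dots> \<le> (\<Sum>k\<in>F. cmod (c k) * cmod (cinner v (f k)))"
    by (intro sum_norm_le) (metis cinner_commute complex_mod_cnj norm_mult order_refl)
  finally have "((norm v)\<^sup>2)\<^sup>2 \<le> (\<Sum>k\<in>F. cmod (c k) * cmod (cinner v (f k)))\<^sup>2"
    by (intro power_mono) simp_all
  also have "\<dots> \<le> s * (\<Sum>k\<in>F. (cmod (cinner v (f k)))\<^sup>2)"
    unfolding s_def by (rule Cauchy_Schwarz_ineq_sum)
  also have "\<dots> \<le> s * (B * (norm v)\<^sup>2)"
    using finite_sum_le_infsum[OF frame_summable \<open>finite F\<close>] frame_upper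
    by (intro mult_left_mono) (auto intro: order_trans simp: s_def sum_nonneg)
  finally have "(norm v)\<^sup>2 * (norm v)\<^sup>2 \<le> (B * s) * (norm v)\<^sup>2"
    by (simp add: power2_eq_square mult_ac)
  moreover have "0 \<le> B * s"
    using frame_bounds_pos by (simp add: s_def sum_nonneg)
  ultimately have "(norm v)\<^sup>2 \<le> B * s"
    by (cases "v = 0") (simp, erule mult_right_le_imp_le, simp)
  then show ?thesis
    by (simp add: v_def s_def)
qed

text \<open>The finite partial sums form a Cauchy net, because the synthesis bound controls them by
  tails of the coefficient series.\<close>

lemma frame_synthesis_summable:
  assumes "(\<lambda>k. (cmod (c k))\<^sup>2) summable_on UNIV"
  shows "(\<lambda>k. c k *\<^sub>C f k) summable_on UNIV"
proof -
  let ?g = "\<lambda>k. c k *\<^sub>C f k"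
  have "\<exists>P. eventually P (finite_subsets_at_top UNIV) \<and>
      (\<forall>F F'. P F \<and> P F' \<longrightarrow> dist (sum ?g F) (sum ?g F') < e)" if "0 < e" for e
  proof -
    \<comment> \<open>Chosen so that \<open>B * d\<close> is half of \<open>(e / 2)\<^sup>2\<close>,
      which leaves room for a strict inequality.\<close>
    define d where "d = (e / 2)\<^sup>2 / (2 * B)"
    have "0 < d"
      using that frame_bounds_pos by (simp add: d_def)
    obtain F0 where F0: "finite F0"
      and approx: "dist (\<Sum>k\<in>F0. (cmod (c k))\<^sup>2) (\<Sum>\<^sub>\<infinity>k. (cmod (c k))\<^sup>2) \<le> d"
      using has_sum_finite_approximation[OF has_sum_infsum[OF assms] \<open>0 < d\<close>] by blast
    have close: "norm (sum ?g F - sum ?g F0) < e / 2" if F: "finite F" "F0 \<subseteq> F" for F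
    proof -
      have "(\<Sum>k\<in>F - F0. (cmod (c k))\<^sup>2) = (\<Sum>k\<in>F. (cmod (c k))\<^sup>2) - (\<Sum>k\<in>F0. (cmod (c k))\<^sup>2)"
        using F by (rule sum_diff)
      also have "\<dots> \<le> d"
        using finite_sum_le_infsum[OF assms F(1)] approx by (simp add: dist_real_def)
      finally have small: "(\<Sum>k\<in>F - F0. (cmod (c k))\<^sup>2) \<le> d" .
      have "(norm (sum ?g (F - F0)))\<^sup>2 \<le> B * (\<Sum>k\<in>F - F0. (cmod (c k))\<^sup>2)"
        using F by (intro frame_synthesis_bound) simp
      also have "\<dots> \<le> B * d"
        using small frame_bounds_pos by simp
      also have "\<dots> < (e / 2)\<^sup>2"
        using frame_bounds_pos \<open>0 < e\<close> by (simp add: d_def)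
      finally show ?thesis
        using F \<open>0 < e\<close> by (intro power2_less_imp_less[of _ "e / 2"]) (simp_all add: sum_diff)
    qed
    have "dist (sum ?g F) (sum ?g F') < e"
      if "finite F \<and> F0 \<subseteq> F" "finite F' \<and> F0 \<subseteq> F'" for F F'
      using close[of F] close[of F'] that norm_triangle_ineq4[of "sum ?g F - sum ?g F0" "sum ?g F' - sum ?g F0"]
      by (simp add: dist_norm)
    moreover have "eventually (\<lambda>F. finite F \<and> F0 \<subseteq> F) (finite_subsets_at_top UNIV)"
      using F0 by (auto simp: eventually_finite_subsets_at_top)
    ultimately show ?thesis
      by blast
  qed
  then have "cauchy_filter (filtermap (sum ?g) (finite_subsets_at_top UNIV))"
    by (simp add: cauchy_filter_metric_filtermap)
  moreover have "complete (UNIV :: 'a set)"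
    by (meson Cauchy_convergent UNIV_I complete_def convergent_def)
  ultimately obtain L where "(sum ?g \<longlongrightarrow> L) (finite_subsets_at_top UNIV)"
    using complete_uniform[where S = UNIV] by (force simp: filterlim_def)
  then show ?thesis
    by (auto simp: summable_on_def has_sum_def)
qed

lemma frame_operator_has_sum: "((\<lambda>k. cinner x (f k) *\<^sub>C f k) has_sum frame_operator f x) UNIV"
  unfolding frame_operator_def
  by (intro has_sum_infsum frame_synthesis_summable frame_summable)

lemma cinner_frame_operator_has_sum:
  "((\<lambda>k. cinner x (f k) * cinner (f k) y) has_sum cinner (frame_operator f x) y) UNIV"
  using has_sum_bounded_linear[OF bounded_linear_cinner_left frame_operator_has_sum]
  by (simp add: cinner_scaleC_left)

lemma cinner_frame_operator_self:
  "cinner (frame_operator f x) x = (\<Sum>\<^sub>\<infinity>k. (cmod (cinner x (f k)))\<^sup>2)"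
proof -
  have "cinner x (f k) * cinner (f k) x = complex_of_real ((cmod (cinner x (f k)))\<^sup>2)" for k
    by (metis cinner_commute complex_norm_square)
  then have "((\<lambda>k. complex_of_real ((cmod (cinner x (f k)))\<^sup>2)) has_sum cinner (frame_operator f x) x) UNIV"
    using cinner_frame_operator_has_sum[of x x] by simp
  then show ?thesis
    using has_sum_of_real[OF has_sum_infsum[OF frame_summable]] has_sum_unique by blast
qed

lemma cinner_frame_operator_adjoint:
  "cinner (frame_operator f x) y = cinner x (frame_operator f y)"
proof -
  have "((\<lambda>k. cnj (cinner y (f k) * cinner (f k) x)) has_sum cnj (cinner (frame_operator f y) x)) UNIV"
    using cinner_frame_operator_has_sum by (subst has_sum_cnj_iff)
  moreover have "cnj (cinner y (f k) * cinner (f k) x) = cinner x (f k) * cinner (f k) y" for k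
    by (metis cinner_commute complex_cnj_mult mult.commute)
  ultimately have "((\<lambda>k. cinner x (f k) * cinner (f k) y) has_sum cinner x (frame_operator f y)) UNIV"
    by (simp only: cinner_commute[symmetric])
  then show ?thesis
    using cinner_frame_operator_has_sum has_sum_unique by blast
qed

lemma frame_operator_scaleC: "frame_operator f (c *\<^sub>C x) = c *\<^sub>C frame_operator f x"
  using has_sum_bounded_linear[OF bounded_linear_scaleC frame_operator_has_sum[of x], of c]
  by (intro has_sum_unique[OF frame_operator_has_sum]) (simp add: cinner_scaleC_left scaleC_scaleC)

lemma linear_frame_operator: "linear (frame_operator f)"
proof (rule linearI)
  show "frame_operator f (x + y) = frame_operator f x + frame_operator f y" for x y
    using has_sum_add[OF frame_operator_has_sum[of x] frame_operator_has_sum[of y]]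
    by (intro has_sum_unique[OF frame_operator_has_sum]) (simp add: cinner_add_left scaleC_add_left)
  show "frame_operator f (r *\<^sub>R x) = r *\<^sub>R frame_operator f x" for r x
    by (simp add: frame_operator_scaleC flip: scaleC_of_real)
qed

lemma frame_operator_inverse_square_root:
  assumes "A \<le> B"
  obtains R where "linear R"
    and "\<And>x y. cinner (R x) y = cinner x (R y)"
    and "\<And>x. frame_operator f (R (R x)) = x"
    and "\<And>x. R (R (frame_operator f x)) = x"
    and "\<And>x. (norm x)\<^sup>2 / sqrt B \<le> inner (R x) x"
    and "\<And>x. inner (R x) x \<le> (norm x)\<^sup>2 / sqrt A"
    and "\<And>V x. bounded_linear V \<Longrightarrow> (\<And>x. V (frame_operator f x) = frame_operator f (V x))
            \<Longrightarrow> V (R x) = R (V x)"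
proof (rule inverse_square_root[where S = "frame_operator f" and A = A and B = B])
  show "inner (frame_operator f x) y = inner x (frame_operator f y)" for x y
    by (simp add: inner_eq_Re_cinner cinner_frame_operator_adjoint)
  have "inner (frame_operator f x) x = (\<Sum>\<^sub>\<infinity>k. (cmod (cinner x (f k)))\<^sup>2)" for x
    by (simp add: inner_eq_Re_cinner cinner_frame_operator_self)
  then show "A * (norm x)\<^sup>2 \<le> inner (frame_operator f x) x"
    and "inner (frame_operator f x) x \<le> B * (norm x)\<^sup>2" for x
    by (simp_all add: frame_lower frame_upper)
next
  fix R
  assume R: "linear R" "\<And>x y. inner (R x) y = inner x (R y)"
    "\<And>x. frame_operator f (R (R x)) = x" "\<And>x. R (R (frame_operator f x)) = x"
    "\<And>x. (norm x)\<^sup>2 / sqrt B \<le> inner (R x) x" "\<And>x. inner (R x) x \<le> (norm x)\<^sup>2 / sqrt A"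
    and comm: "\<And>V x. bounded_linear V \<Longrightarrow> (\<And>x. V (frame_operator f x) = frame_operator f (V x))
      \<Longrightarrow> V (R x) = R (V x)"
  have "R (c *\<^sub>C x) = c *\<^sub>C R x" for c x
    using comm[OF bounded_linear_scaleC] by (simp add: frame_operator_scaleC)
  then have "cinner (R x) y = cinner x (R y)" for x y
    using R(2) by (intro cinner_adjoint_if_inner_adjoint)
  with R comm show thesis
    using that by blast
qed (use assms linear_frame_operator frame_bounds_pos in auto)

text \<open>The canonical tight frame: with \<open>R = S powr (- 1 / 2)\<close> one has
  \<open>(\<Sum>k. \<bar>\<langle>x, R f\<^sub>k\<rangle>\<bar>\<^sup>2) = \<langle>S R x, R x\<rangle> = \<langle>x, x\<rangle>\<close>.\<close>

lemma canonical_tight_frame: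
  assumes adj: "\<And>x y. cinner (R x) y = cinner x (R y)"
    and inverse: "\<And>x. R (R (frame_operator f x)) = x" "\<And>x. frame_operator f (R (R x)) = x"
    and "0 < c"
  shows "frame_with_bounds (\<lambda>k. sqrt c *\<^sub>R R (f k)) c c"
proof -
  have comm: "R (frame_operator f (R x)) = x" for x
    by (metis inverse)
  have sq: "(cmod (cinner x (sqrt c *\<^sub>R R (f k))))\<^sup>2 = c * (cmod (cinner (R x) (f k)))\<^sup>2" for x k
    using \<open>0 < c\<close>
    by (simp add: cinner_scaleC_right norm_mult power_mult_distrib adj flip: scaleC_of_real)
  have "((\<lambda>k. (cmod (cinner (R x) (f k)))\<^sup>2) has_sum (norm x)\<^sup>2) UNIV" for x
  proof -
    have "complex_of_real (\<Sum>\<^sub>\<infinity>k. (cmod (cinner (R x) (f k)))\<^sup>2) = complex_of_real ((norm x)\<^sup>2)"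
      unfolding cinner_frame_operator_self[symmetric] cinner_self[symmetric]
      by (metis adj comm)
    then show ?thesis
      using has_sum_infsum[OF frame_summable, of "R x"] by (metis of_real_eq_iff)
  qed
  then have sum: "((\<lambda>k. (cmod (cinner x (sqrt c *\<^sub>R R (f k))))\<^sup>2) has_sum c * (norm x)\<^sup>2) UNIV" for x
    unfolding sq by (intro has_sum_cmult_right)
  then show ?thesis
    using \<open>0 < c\<close> by (simp add: frame_with_bounds_def infsumI[OF sum] has_sum_imp_summable[OF sum])
qed

end

section \<open>Group-like unitary systems\<close>

lemma group_like_closed:
  assumes "group_like \<U>" and "V \<in> generate (BijGroup UNIV) \<U>"
  obtains t W where "cmod t = 1" "W \<in> \<U>" "\<And>x. V x = t *\<^sub>C W x"
  using assms unfolding group_like_def by fastforce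

lemma unitary_in_Bij: "unitary U \<Longrightarrow> U \<in> Bij UNIV"
  using unitary_bij by (simp add: Bij_def)

lemma group_like_comp:
  assumes "unitary_system \<U>" "group_like \<U>" "V \<in> \<U>" "W \<in> \<U>"
  obtains t X where "cmod t = 1" "X \<in> \<U>" "\<And>x. V (W x) = t *\<^sub>C X x"
proof -
  have "V \<in> Bij UNIV" "W \<in> Bij UNIV"
    using assms by (auto simp: unitary_system_def unitary_in_Bij)
  then have "V \<otimes>\<^bsub>BijGroup UNIV\<^esub> W = V \<circ> W"
    by (simp add: BijGroup_def compose_def o_def restrict_UNIV)
  then have "V \<circ> W \<in> generate (BijGroup UNIV) \<U>"
    using assms by (metis generate.incl generate.eng)
  from group_like_closed[OF assms(2) this] show thesis
    using that by auto
qed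

lemma group_like_inv_comp:
  assumes "unitary_system \<U>" "group_like \<U>" "V \<in> \<U>" "W \<in> \<U>"
  obtains t X where "cmod t = 1" "X \<in> \<U>" "\<And>x. W x = t *\<^sub>C V (X x)"
proof -
  have VW: "V \<in> Bij UNIV" "W \<in> Bij UNIV" and V: "unitary V"
    using assms by (auto simp: unitary_system_def unitary_in_Bij)
  then have "inv\<^bsub>BijGroup UNIV\<^esub> V = inv_into UNIV V" "inv_into UNIV V \<in> Bij UNIV"
    using restrict_inv_into_Bij[OF VW(1)] by (simp_all add: inv_BijGroup restrict_UNIV)
  then have "inv\<^bsub>BijGroup UNIV\<^esub> V \<otimes>\<^bsub>BijGroup UNIV\<^esub> W = inv_into UNIV V \<circ> W"
    using VW by (simp add: BijGroup_def compose_def o_def restrict_UNIV)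
  then have "inv_into UNIV V \<circ> W \<in> generate (BijGroup UNIV) \<U>"
    using assms by (metis generate.incl generate.inv generate.eng)
  from group_like_closed[OF assms(2) this] obtain t X
    where X: "cmod t = 1" "X \<in> \<U>" "\<And>x. inv_into UNIV V (W x) = t *\<^sub>C X x"
    by auto
  then have "W x = t *\<^sub>C V (X x)" for x
    using V by (metis bij_inv_eq_iff unitary_bij unitary_scaleC)
  with X show thesis
    using that by blast
qed

lemma group_like_proportional_eq:
  assumes "group_like \<U>" "V \<in> \<U>" "W \<in> \<U>" "c \<noteq> 0" "\<And>x. c *\<^sub>C V x = d *\<^sub>C W x"
  shows "V = W"
proof (rule ccontr)
  assume "V \<noteq> W"
  moreover have "c *\<^sub>C V x + (- d) *\<^sub>C W x = 0" for x
    using assms(5) by simp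
  ultimately show False
    using assms(1-4) unfolding group_like_def by blast
qed

lemma group_like_translation:
  assumes \<U>: "unitary_system \<U>" "group_like \<U>" and U: "bij_betw U UNIV \<U>"
  obtains \<sigma> t where "bij (\<sigma> :: 'i \<Rightarrow> 'i)" and "\<And>k. cmod (t k) = 1"
    and "\<And>k x. U j (U k x) = t k *\<^sub>C U (\<sigma> k) x"
proof -
  have mem: "U k \<in> \<U>" for k
    using U by (auto simp: bij_betw_def)
  then have unitary: "unitary (U k)" for k
    using \<U>(1) by (simp add: unitary_system_def)
  have index: "\<exists>k. V = U k" if "V \<in> \<U>" for V
    using U that by (auto simp: bij_betw_def)
  have inj: "k = l" if "c \<noteq> 0" "\<And>x. c *\<^sub>C U k x = d *\<^sub>C U l x" for k l c d
    using group_like_proportional_eq[OF \<U>(2) mem mem that] U by (auto simp: bij_betw_def inj_def)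
  have "\<forall>k. \<exists>m s. cmod s = 1 \<and> (\<forall>x. U j (U k x) = s *\<^sub>C U m x)"
    by (metis group_like_comp[OF \<U> mem mem] index)
  then obtain \<sigma> t where t: "\<And>k. cmod (t k) = 1" and \<sigma>: "\<And>k x. U j (U k x) = t k *\<^sub>C U (\<sigma> k) x"
    by metis
  have t0: "t k \<noteq> 0" for k
    using t[of k] by auto
  have "bij \<sigma>"
  proof (rule bijI)
    show "inj \<sigma>"
    proof (rule injI)
      fix k l assume eq: "\<sigma> k = \<sigma> l"
      have "U j (t l *\<^sub>C U k x) = U j (t k *\<^sub>C U l x)" for x
        by (simp add: unitary_scaleC[OF unitary] \<sigma> eq scaleC_scaleC mult.commute)
      then have "t l *\<^sub>C U k x = t k *\<^sub>C U l x" for x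
        using unitary_bij[OF unitary] by (metis bij_is_inj injD)
      then show "k = l"
        by (rule inj[OF t0])
    qed
    show "surj \<sigma>"
      unfolding surj_def
    proof
      fix m
      obtain k s where s: "\<And>x. U m x = s *\<^sub>C U j (U k x)"
        by (metis group_like_inv_comp[OF \<U> mem mem] index)
      have "m = \<sigma> k"
        by (rule inj[of 1 _ "s * t k"]) (simp_all add: s \<sigma> scaleC_scaleC)
      then show "\<exists>k. m = \<sigma> k" ..
    qed
  qed
  with t \<sigma> show thesis
    using that by blast
qed

lemma frame_operator_commute_unitary:
  assumes \<U>: "unitary_system \<U>" "group_like \<U>" and U: "bij_betw U UNIV \<U>"
    and f: "\<And>k. f k = U k f\<^sub>0" and frame: "frame_with_bounds f A B"
  shows "U j (frame_operator f x) = frame_operator f (U j x)"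
proof -
  obtain \<sigma> t where \<sigma>: "bij \<sigma>" and t: "\<And>k. cmod (t k) = 1"
    and Uf: "\<And>k x. U j (U k x) = t k *\<^sub>C U (\<sigma> k) x"
    using group_like_translation[OF \<U> U, of j] by blast
  have Uj: "unitary (U j)"
    using U \<U>(1) by (auto simp: unitary_system_def bij_betw_def)
  have "U j (cinner x (f k) *\<^sub>C f k) = cinner (U j x) (f (\<sigma> k)) *\<^sub>C f (\<sigma> k)" for k
  proof -
    have "t k * cnj (t k) = 1"
      using t[of k] by (simp flip: complex_norm_square)
    have "U j (cinner x (f k) *\<^sub>C f k) = cinner (U j x) (U j (f k)) *\<^sub>C U j (f k)"
      by (simp add: unitary_scaleC[OF Uj] unitary_cinner[OF Uj])
    also have "\<dots> = (t k * cnj (t k) * cinner (U j x) (f (\<sigma> k))) *\<^sub>C f (\<sigma> k)"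
      by (simp add: f Uf cinner_scaleC_right scaleC_scaleC mult_ac)
    finally show ?thesis
      using \<open>t k * cnj (t k) = 1\<close> by simp
  qed
  then have "((\<lambda>k. cinner (U j x) (f (\<sigma> k)) *\<^sub>C f (\<sigma> k)) has_sum U j (frame_operator f x)) UNIV"
    using has_sum_bounded_linear[OF unitary_bounded_linear[OF Uj] frame_operator_has_sum[OF frame, of x]] by simp
  then have "((\<lambda>k. cinner (U j x) (f k) *\<^sub>C f k) has_sum U j (frame_operator f x)) UNIV"
    using has_sum_reindex_bij_betw[OF \<sigma>, of "\<lambda>k. cinner (U j x) (f k) *\<^sub>C f k"] by simp
  then show ?thesis
    using frame_operator_has_sum[OF frame] has_sum_unique by blast
qed

lemma cmod_cinner_diff_le:
  fixes x :: "'a::complex_hilbert_space"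
  assumes "norm y = 1" "norm x' = 1" "norm (x' - x) \<le> e" "norm (y' - y) \<le> e"
  shows "cmod (cinner x' y') \<le> cmod (cinner x y) + 2 * e"
proof -
  have eq: "cinner x' y' = cinner x y + (cinner (x' - x) y + cinner x' (y' - y))"
    by (simp add: cinner_diff_left cinner_diff_right)
  have "cmod (cinner x' y') \<le> cmod (cinner x y) + (cmod (cinner (x' - x) y) + cmod (cinner x' (y' - y)))"
    unfolding eq by (rule order_trans[OF norm_triangle_ineq add_left_mono[OF norm_triangle_ineq]])
  moreover have "cmod (cinner (x' - x) y) \<le> e" "cmod (cinner x' (y' - y)) \<le> e"
    using cmod_cinner_le[of "x' - x" y] cmod_cinner_le[of x' "y' - y"] assms by simp_all
  ultimately show ?thesis
    by linarith
qed

theorem theorem3p5: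
  fixes \<U> :: "('a::complex_hilbert_space \<Rightarrow> 'a) set"
    and \<Phi> :: "'a set" and \<rho> A B :: real
    and f :: "nat \<Rightarrow> 'a" and U :: "nat \<Rightarrow> 'a \<Rightarrow> 'a" and f\<^sub>0 :: 'a
  assumes "separable_space (euclidean :: 'a topology)"
    and "infinite_dimensional TYPE('a)"
    and "unitary_system \<U>" and "group_like \<U>"
    and "\<And>\<phi>. \<phi> \<in> \<Phi> \<Longrightarrow> norm \<phi> = 1"
    and "grassmannian_frame \<U> \<Phi> \<rho> f"
    and "frame_with_bounds f A B"
    and "bij_betw U UNIV \<U>" and "f\<^sub>0 \<in> \<Phi>" and "\<And>k. f k = U k f\<^sub>0"
  shows "\<exists>h h\<^sub>0. tight_frame h \<and> uniform h \<and> (\<forall>k. h k = U k h\<^sub>0) \<and>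
           max_correlation h \<le> max_correlation f
             + 2 * max \<bar>1 - sqrt (\<rho> / A)\<bar> \<bar>1 - sqrt (\<rho> / B)\<bar>"
proof -
  note frame = assms(7) and f = assms(10)
  have unitary: "unitary (U k)" for k
    using assms(3,8) by (auto simp: unitary_system_def bij_betw_def)
  have norm_f0: "norm f\<^sub>0 = 1"
    using assms(5,9) by blast
  have "A \<le> B"
    using frame_lower[OF frame, of f\<^sub>0] frame_upper[OF frame, of f\<^sub>0] by (simp add: norm_f0)
  obtain R where "linear R"
    and adj: "\<And>x y. cinner (R x) y = cinner x (R y)"
    and SRR: "\<And>x. frame_operator f (R (R x)) = x"
    and RRS: "\<And>x. R (R (frame_operator f x)) = x"
    and ge: "\<And>x. (norm x)\<^sup>2 / sqrt B \<le> inner (R x) x"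
    and le: "\<And>x. inner (R x) x \<le> (norm x)\<^sup>2 / sqrt A"
    and comm: "\<And>V x. bounded_linear V \<Longrightarrow> (\<And>x. V (frame_operator f x) = frame_operator f (V x))
      \<Longrightarrow> V (R x) = R (V x)"
    by (rule frame_operator_inverse_square_root[OF frame \<open>A \<le> B\<close>]) blast
  have RU: "U k (R x) = R (U k x)" for k x
    using frame_operator_commute_unitary[OF assms(3,4,8) f frame]
    by (intro comm unitary_bounded_linear unitary)

  have "has_redundancy f \<rho>"
    using assms(6) by (auto simp: grassmannian_frame_def is_arg_min_def frame_family_def)
  then obtain L where L: "L \<noteq> 0" "\<rho> = inverse L"
    and lim: "(\<lambda>K. (\<Sum>k<K. cinner (f k) (inv_into UNIV (frame_operator f) (f k))) / of_nat K)
          \<longlonglongrightarrow> complex_of_real L"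
    unfolding has_redundancy_def by blast
  have "inj (frame_operator f)"
    using RRS by (rule inj_on_inverseI)
  then have "inv_into UNIV (frame_operator f) x = R (R x)" for x
    using SRR by (rule inv_f_eq)
  then have "cinner (f k) (inv_into UNIV (frame_operator f) (f k)) = complex_of_real ((norm (R f\<^sub>0))\<^sup>2)" for k
  proof -
    have "norm (R (f k)) = norm (R f\<^sub>0)"
      by (simp add: f unitary_norm[OF unitary] flip: RU)
    with \<open>\<And>x. inv_into UNIV (frame_operator f) x = R (R x)\<close> show ?thesis
      by (simp add: adj[symmetric] cinner_self)
  qed
  then have "(\<lambda>K. (\<Sum>k<K. cinner (f k) (inv_into UNIV (frame_operator f) (f k))) / of_nat K)
      = (\<lambda>K. if K = 0 then 0 else complex_of_real ((norm (R f\<^sub>0))\<^sup>2))"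
    by (simp add: fun_eq_iff)
  moreover have "\<dots> \<longlonglongrightarrow> complex_of_real ((norm (R f\<^sub>0))\<^sup>2)"
    by (rule tendsto_eventually) (auto simp: eventually_sequentially intro: exI[of _ 1])
  ultimately have "L = (norm (R f\<^sub>0))\<^sup>2"
    using lim LIMSEQ_unique by (metis of_real_eq_iff)
  with L have \<rho>: "0 < \<rho>" "\<rho> * (norm (R f\<^sub>0))\<^sup>2 = 1"
    by simp_all

  define h\<^sub>0 where "h\<^sub>0 = sqrt \<rho> *\<^sub>R R f\<^sub>0"
  define h where "h k = U k h\<^sub>0" for k
  define m where "m = max \<bar>1 - sqrt (\<rho> / A)\<bar> \<bar>1 - sqrt (\<rho> / B)\<bar>"
  have h_eq: "h k = sqrt \<rho> *\<^sub>R R (f k)" for k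
    using linear_cmul[OF bounded_linear.linear[OF unitary_bounded_linear[OF unitary]]]
    by (simp add: h_def h\<^sub>0_def f RU)
  have "(norm h\<^sub>0)\<^sup>2 = 1"
    using \<rho> by (simp add: h\<^sub>0_def power_mult_distrib)
  then have norm_h: "norm (h k) = 1" for k
    by (simp add: h_def unitary_norm[OF unitary] power2_eq_1_iff) (smt (verit) norm_ge_zero)
  have norm_f: "norm (f k) = 1" for k
    by (simp add: f unitary_norm[OF unitary] norm_f0)

  have "norm (f\<^sub>0 - h\<^sub>0) \<le> m * norm f\<^sub>0"
    unfolding h\<^sub>0_def
  proof (rule norm_le_of_quadratic_form_le[where D = "\<lambda>x. x - sqrt \<rho> *\<^sub>R R x"])
    show "linear (\<lambda>x. x - sqrt \<rho> *\<^sub>R R x)"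
      using \<open>linear R\<close> by (intro linear_compose_sub linear_compose_scale_right linear_ident)
    show "inner (x - sqrt \<rho> *\<^sub>R R x) y = inner x (y - sqrt \<rho> *\<^sub>R R y)" for x y
    proof -
      have "inner (R x) y = inner x (R y)"
        by (simp add: inner_eq_Re_cinner adj)
      then show ?thesis
        by (simp add: inner_simps)
    qed
    fix x
    have "inner (x - sqrt \<rho> *\<^sub>R R x) x = (norm x)\<^sup>2 - sqrt \<rho> * inner (R x) x"
      by (simp add: inner_simps power2_norm_eq_inner)
    moreover have "sqrt (\<rho> / B) * (norm x)\<^sup>2 \<le> sqrt \<rho> * inner (R x) x"
      and "sqrt \<rho> * inner (R x) x \<le> sqrt (\<rho> / A) * (norm x)\<^sup>2"
      using mult_left_mono[OF ge[of x], of "sqrt \<rho>"] mult_left_mono[OF le[of x], of "sqrt \<rho>"] \<rho>(1)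
      by (simp_all add: real_sqrt_divide)
    moreover have "(1 - sqrt (\<rho> / B)) * (norm x)\<^sup>2 \<le> m * (norm x)\<^sup>2"
      and "(sqrt (\<rho> / A) - 1) * (norm x)\<^sup>2 \<le> m * (norm x)\<^sup>2"
      by (intro mult_right_mono; simp add: m_def)+
    ultimately show "\<bar>inner (x - sqrt \<rho> *\<^sub>R R x) x\<bar> \<le> m * (norm x)\<^sup>2"
      by (simp add: left_diff_distrib)
  qed
  then have "norm (h k - f k) \<le> m" for k
    using linear_diff[OF bounded_linear.linear[OF unitary_bounded_linear[OF unitary]]]
      unitary_norm[OF unitary, of k "h\<^sub>0 - f\<^sub>0"]
    by (simp add: h_def f norm_f0 norm_minus_commute)
  then have close: "cmod (cinner (h k) (h l)) \<le> cmod (cinner (f k) (f l)) + 2 * m" for k l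
    using norm_f norm_h by (intro cmod_cinner_diff_le)

  have "bdd_above ((\<lambda>(k, l). cmod (cinner (f k) (f l))) ` {(k, l). k \<noteq> l})"
    using cmod_cinner_le[of "f _" "f _"] by (intro bdd_aboveI[of _ 1]) (auto simp: norm_f)
  from cSUP_upper[OF _ this]
  have "cmod (cinner (f k) (f l)) \<le> max_correlation f" if "k \<noteq> l" for k l
    unfolding max_correlation_def using that by fastforce
  then have "cmod (cinner (h k) (h l)) \<le> max_correlation f + 2 * m" if "k \<noteq> l" for k l
    using close[of k l] that by (meson add_right_mono order_trans)
  then have "max_correlation h \<le> max_correlation f + 2 * m"
    unfolding max_correlation_def[of h] by (intro cSUP_least) auto
  moreover have "tight_frame h"
    unfolding tight_frame_def h_eq
    using canonical_tight_frame[OF frame adj RRS SRR \<rho>(1)] by blast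
  moreover have "uniform h"
    by (simp add: uniform_def norm_h)
  ultimately show ?thesis
    unfolding m_def using h_def by blast
qed

end
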